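(* Let $0<\alpha\le1$, $\delta>0$, $\lambda>0$ and $n\ge1$. Let $X$ be a generalized Mittag-Leffler random variable with parameters $\alpha$, $\delta$ and $\lambda$, and let $Y=Y_1+Y_2+\dots+Y_n$, where $X,Y_1,\dots,Y_n$ are mutually independent and $\mathrm{Pr}\{Y_i>t\}=E_\alpha(-\lambda t^\alpha)$, $t\ge0$, for all $1\le i\le n$. Then $X+Y$ has the generalized Mittag-Leffler distribution with parameters $\alpha$, $\delta+n$ and $\lambda$.
   Context: For $\alpha,\beta,\gamma>0$ the three-parameter Mittag-Leffler function is $E_{\alpha,\beta}^{\gamma}(x)=\sum_{k=0}^{\infty}\frac{(\gamma)_kx^k}{k!\,\Gamma(\alpha k+\beta)}$, with $(\gamma)_k=\Gamma(\gamma+k)/\Gamma(\gamma)$, and $E_\alpha=E_{\alpha,1}^1$. A non-negative random variable $X$ is generalized Mittag-Leffler with parameters $\alpha\in(0,1]$, $\delta>0$, $\lambda>0$ if $\mathbb{E}(e^{-zX})=\left(\frac{\lambda}{z^\alpha+\lambda}\right)^{\delta}$ for $z>0$; equivalently, its density is $f_X(t)=\lambda^\delta t^{\alpha\delta-1}E_{\alpha,\alpha\delta}^{\delta}(-\lambda t^\alpha)$, $t>0$. *)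

theory Defs
  imports "HOL-Probability.Probability"
begin

text \<open>For \<open>\<gamma> > 0\<close> the library's \<open>pochhammer \<gamma> k\<close> equals \<open>Gamma (\<gamma> + k) / Gamma \<gamma>\<close>
  (lemma \<open>pochhammer_Gamma\<close>).  The parameters are meant to be positive; the series then
  converges for every \<open>x\<close>, so the \<open>suminf\<close> below is a genuine sum.\<close>

definition mittag_leffler3 :: "real \<Rightarrow> real \<Rightarrow> real \<Rightarrow> real \<Rightarrow> real" where
  "mittag_leffler3 \<alpha> \<beta> \<gamma> x =
     (\<Sum>k. pochhammer \<gamma> k * x ^ k / (fact k * Gamma (\<alpha> * real k + \<beta>)))"

definition mittag_leffler :: "real \<Rightarrow> real \<Rightarrow> real" where
  "mittag_leffler \<alpha> = mittag_leffler3 \<alpha> 1 1"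

text \<open>Non-negativity is required almost surely: a distribution determines its random variable
  only up to null sets.  The parameter \<open>l\<close> is the rate (the lambda of the literature).\<close>

definition (in prob_space) generalized_mittag_leffler ::
    "('a \<Rightarrow> real) \<Rightarrow> real \<Rightarrow> real \<Rightarrow> real \<Rightarrow> bool" where
  "generalized_mittag_leffler X \<alpha> \<delta> l \<longleftrightarrow>
     0 < \<alpha> \<and> \<alpha> \<le> 1 \<and> 0 < \<delta> \<and> 0 < l \<and>
     random_variable borel X \<and> (AE \<omega> in M. 0 \<le> X \<omega>) \<and>
     (\<forall>z>0. expectation (\<lambda>\<omega>. exp (- z * X \<omega>)) = (l / (z powr \<alpha> + l)) powr \<delta>)"

end

theory Submission
  imports Defs
begin

text \<open>
  Laplace transforms of independent non-negative variables multiply, so everything rests on one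
  fact: a variable with tail \<open>E\<^sub>\<alpha>(- l t\<^sup>\<alpha>)\<close> has Laplace transform \<open>l / (z\<^sup>\<alpha> + l)\<close>, that is, it is
  generalized Mittag-Leffler with \<open>\<delta> = 1\<close> (\<open>mittag_leffler_tail_imp_laplace\<close>).  The
  \<open>n\<close> summands then contribute the \<open>n\<close>-th power of this, which raises the exponent
  from \<open>\<delta>\<close> to \<open>\<delta> + n\<close>.

  Write \<open>G(t) = E\<^sub>\<alpha>(- l t\<^sup>\<alpha>)\<close>.  Layer-cake integration turns the fact into a formula for the
  Laplace transform of \<open>G\<close> itself.  Integrating the series of \<open>G\<close> against
  \<open>exp (- z t)\<close> term by term converges only for \<open>z\<^sup>\<alpha> > l\<close> and would leave the other \<open>z\<close> to an
  analytic continuation.  Instead, term-by-term integration over the bounded interval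
  from \<open>0\<close> to \<open>t\<close>, with Beta integrals, gives the fractional integral equation
  \<open>\<integral>\<^sub>0\<^sup>t (t - s)\<^sup>\<alpha>\<^sup>-\<^sup>1 G(s) ds = \<Gamma>(\<alpha>) (1 - G(t)) / l\<close> for every \<open>t > 0\<close>
  (\<open>mittag_leffler_volterra\<close>).  Since \<open>G\<close> is a tail probability, both \<open>G\<close> and
  \<open>1 - G\<close> are non-negative, so Tonelli's theorem applies to this equation for every \<open>z > 0\<close>: the
  Laplace transform \<open>L\<close> of \<open>G\<close> satisfies \<open>L \<Gamma>(\<alpha>) / z\<^sup>\<alpha> = \<Gamma>(\<alpha>) (1/z - L) / l\<close>, a linear
  equation with solution \<open>L = z\<^sup>\<alpha> / (z (z\<^sup>\<alpha> + l))\<close> (\<open>nn_integral_laplace_mittag_leffler\<close>).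
\<close>

section \<open>The Mittag-Leffler series\<close>

text \<open>The Gamma integrand restricted to arguments above \<open>A\<close> already has at least this mass.  Letting
  \<open>A\<close> be free gives geometric bounds of any ratio for the terms of the series below.\<close>

lemma power_exp_le_Gamma:
  fixes s A :: real
  assumes "0 \<le> s" "0 < A"
  shows "A powr s * exp (- A) \<le> Gamma (s + 1)"
proof -
  have G: "((\<lambda>t. t powr s / exp t) has_integral Gamma (s + 1)) {0..}"
    using Gamma_integral_real[of "s + 1"] assms by simp
  have E: "((\<lambda>t. A powr s * exp (- t)) has_integral A powr s * exp (- A)) {A..}"
    using has_integral_mult_right[OF has_integral_exp_minus_to_infinity[of 1 A]] by simp
  have R: "((\<lambda>t. if t \<in> {A..} then A powr s * exp (- t) else 0) has_integral A powr s * exp (- A)) {0..}"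
    using E assms by (subst has_integral_restrict) auto
  show ?thesis
    by (rule has_integral_le[OF R G])
       (use assms in \<open>auto simp: exp_minus divide_inverse intro!: powr_mono2\<close>)
qed

lemma summable_mittag_leffler:
  fixes \<alpha> x :: real
  assumes "0 < \<alpha>"
  shows "summable (\<lambda>k. x ^ k / Gamma (\<alpha> * real k + 1))"
proof -
  \<comment> \<open>The choice makes \<open>A\<close> to the \<open>\<alpha>\<close> exceed twice the absolute value of \<open>x\<close>, so that the
    bounds on the terms form a geometric series of ratio below one half.\<close>
  define A where "A = (2 * \<bar>x\<bar> + 1) powr (1 / \<alpha>)"
  have A: "0 < A" "A powr \<alpha> = 2 * \<bar>x\<bar> + 1"
    using assms by (auto simp: A_def powr_powr)
  show ?thesis
  proof (rule summable_comparison_test)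
    show "summable (\<lambda>k. exp A * (\<bar>x\<bar> / (2 * \<bar>x\<bar> + 1)) ^ k)"
      by (intro summable_mult summable_geometric) (auto simp: divide_simps)
    have "norm (x ^ k / Gamma (\<alpha> * real k + 1)) \<le> exp A * (\<bar>x\<bar> / (2 * \<bar>x\<bar> + 1)) ^ k" for k
    proof -
      have "A powr (\<alpha> * real k) = (2 * \<bar>x\<bar> + 1) ^ k"
        using A by (simp flip: powr_powr add: powr_realpow)
      hence "(2 * \<bar>x\<bar> + 1) ^ k * exp (- A) \<le> Gamma (\<alpha> * real k + 1)"
        using power_exp_le_Gamma[of "\<alpha> * real k" A] assms A by simp
      hence "\<bar>x\<bar> ^ k / Gamma (\<alpha> * real k + 1) \<le> \<bar>x\<bar> ^ k / ((2 * \<bar>x\<bar> + 1) ^ k * exp (- A))"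
        by (intro divide_left_mono mult_pos_pos Gamma_real_pos) (use assms in \<open>auto intro!: add_nonneg_pos\<close>)
      moreover have "Gamma (\<alpha> * real k + 1) > 0"
        using assms by (intro Gamma_real_pos add_nonneg_pos) auto
      ultimately show ?thesis
        by (simp add: abs_mult power_mult_distrib power_abs exp_minus divide_inverse power_inverse mult_ac)
    qed
    thus "\<exists>N. \<forall>k\<ge>N. norm (x ^ k / Gamma (\<alpha> * real k + 1)) \<le> exp A * (\<bar>x\<bar> / (2 * \<bar>x\<bar> + 1)) ^ k"
      by blast
  qed
qed

lemma mittag_leffler_eq:
  "mittag_leffler \<alpha> x = (\<Sum>k. x ^ k / Gamma (\<alpha> * real k + 1))"
  unfolding mittag_leffler_def mittag_leffler3_def by (simp flip: pochhammer_fact)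

lemma mittag_leffler_sums:
  assumes "0 < \<alpha>"
  shows "(\<lambda>k. x ^ k / Gamma (\<alpha> * real k + 1)) sums mittag_leffler \<alpha> x"
  using summable_mittag_leffler[OF assms] by (simp add: mittag_leffler_eq summable_sums)

lemma mittag_leffler_0: "mittag_leffler \<alpha> 0 = 1"
  unfolding mittag_leffler_eq
  by (subst suminf_finite[of "{0}"]) auto

lemma borel_measurable_mittag_leffler [measurable]:
  "mittag_leffler \<alpha> \<in> borel_measurable borel"
  unfolding mittag_leffler_eq[abs_def] by measurable

section \<open>The fractional integral equation\<close>

text \<open>The Beta integral, rescaled from the unit interval to the interval from \<open>0\<close> to \<open>t\<close>.\<close>

lemma has_bochner_integral_Beta_convolution:
  fixes a b t :: real
  assumes "0 < a" "0 < b" "0 < t"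
  shows "has_bochner_integral lborel
           (\<lambda>s. indicator {0<..<t} s * ((t - s) powr (a - 1) * s powr (b - 1)))
           (Beta a b * t powr (a + b - 1))"
proof -
  \<comment> \<open>Since \<open>0 powr r = 0\<close> for every \<open>r\<close>, this vanishes at both endpoints, so closed and open
    intervals give the same function.\<close>
  define f where "f u = indicator {0..1} u * (u powr (b - 1) * (1 - u) powr (a - 1))" for u :: real
  have int: "set_integrable lborel {0..1} (\<lambda>u. u powr (b - 1) * (1 - u) powr (a - 1))"
    by (rule integrable_Beta) (use assms in auto)
  have "has_bochner_integral lborel f (Beta b a)"
    using int set_borel_integral_eq_integral(2)[OF int]
      integral_unique[OF has_integral_Beta_real[OF assms(2,1)]]
    unfolding has_bochner_integral_iff set_integrable_def set_lebesgue_integral_def f_def by simp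
  hence "has_bochner_integral lborel (\<lambda>s. f (0 + (1/t) * s)) (Beta b a /\<^sub>R \<bar>1/t\<bar>)"
    using assms by (subst lborel_has_bochner_integral_real_affine_iff[symmetric]) auto
  hence "has_bochner_integral lborel (\<lambda>s. t powr (a + b - 2) * f (0 + (1/t) * s))
           (t powr (a + b - 2) * (Beta b a /\<^sub>R \<bar>1/t\<bar>))"
    by (rule has_bochner_integral_mult_right) 
  moreover have "t powr (a + b - 2) * f (0 + (1/t) * s) =
      indicator {0<..<t} s * ((t - s) powr (a - 1) * s powr (b - 1))" for s
  proof (cases "s \<in> {0<..<t}")
    case True
    have "t powr (a + b - 2) = t powr (a - 1) * t powr (b - 1)"
      by (simp flip: powr_add)
    moreover have "1 - s / t = (t - s) / t" using assms by (simp add: field_simps)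
    ultimately show ?thesis
      using True assms by (simp add: f_def powr_divide field_simps)
  next
    case False
    thus ?thesis using assms by (auto simp: f_def indicator_def field_simps)
  qed
  moreover have "t powr (a + b - 2) * (Beta b a /\<^sub>R \<bar>1/t\<bar>) = Beta a b * t powr (a + b - 1)"
  proof -
    have "t powr (a + b - 1) = t powr (a + b - 2 + 1)"
      by (simp add: algebra_simps)
    also have "\<dots> = t powr (a + b - 2) * t"
      using assms by (subst powr_add) simp
    finally have "t powr (a + b - 1) = t powr (a + b - 2) * t" .
    thus ?thesis using assms by (simp add: Beta_commute)
  qed
  ultimately show ?thesis by simp
qed

text \<open>Fractional integration of order \<open>\<alpha>\<close> shifts the series of \<open>s \<mapsto> E\<^sub>\<alpha>(c s\<^sup>\<alpha>)\<close> by one index,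
  because the Beta integral turns its \<open>k\<close>-th term into a multiple of its \<open>(k + 1)\<close>-st;
  the shifted series misses only the constant term \<open>1\<close>.\<close>

lemma mittag_leffler_volterra:
  fixes \<alpha> c t :: real
  assumes "0 < \<alpha>" "0 < t" "c \<noteq> 0"
  shows "has_bochner_integral lborel
           (\<lambda>s. indicator {0<..<t} s * ((t - s) powr (\<alpha> - 1) * mittag_leffler \<alpha> (c * s powr \<alpha>)))
           (Gamma \<alpha> / c * (mittag_leffler \<alpha> (c * t powr \<alpha>) - 1))"
proof -
  define f where "f c k s = indicator {0<..<t} s * ((t - s) powr (\<alpha> - 1) *
      ((c * s powr \<alpha>) ^ k / Gamma (\<alpha> * real k + 1)))" for c k and s :: real
  define v where "v c k = Gamma \<alpha> / c * ((c * t powr \<alpha>) ^ Suc k / Gamma (\<alpha> * real (Suc k) + 1))"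
    for c :: real and k
  have Gpos: "Gamma (\<alpha> * real k + 1) > 0" for k
    using assms by (intro Gamma_real_pos add_nonneg_pos) auto
  have f: "has_bochner_integral lborel (f c k) (v c k)" if "c \<noteq> 0" for c k
  proof -
    have "has_bochner_integral lborel (\<lambda>s. (c ^ k / Gamma (\<alpha> * real k + 1)) *
        (indicator {0<..<t} s * ((t - s) powr (\<alpha> - 1) * s powr (\<alpha> * real k + 1 - 1))))
       ((c ^ k / Gamma (\<alpha> * real k + 1)) * (Beta \<alpha> (\<alpha> * real k + 1) * t powr (\<alpha> + (\<alpha> * real k + 1) - 1)))"
      by (intro has_bochner_integral_mult_right has_bochner_integral_Beta_convolution)
         (use assms in \<open>auto intro: add_nonneg_pos\<close>)
    moreover have "(c ^ k / Gamma (\<alpha> * real k + 1)) *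
        (indicator {0<..<t} s * ((t - s) powr (\<alpha> - 1) * s powr (\<alpha> * real k + 1 - 1))) = f c k s" for s
    proof (cases "0 < s")
      case True
      hence "s powr (\<alpha> * real k) = (s powr \<alpha>) ^ k"
        by (simp flip: powr_powr add: powr_realpow)
      thus ?thesis by (simp add: f_def power_mult_distrib)
    qed (simp add: f_def)
    moreover have "(c ^ k / Gamma (\<alpha> * real k + 1)) *
        (Beta \<alpha> (\<alpha> * real k + 1) * t powr (\<alpha> + (\<alpha> * real k + 1) - 1)) = v c k"
    proof -
      have "t powr (\<alpha> + (\<alpha> * real k + 1) - 1) = (t powr \<alpha>) powr real (Suc k)"
        by (simp add: powr_powr algebra_simps)
      also have "\<dots> = (t powr \<alpha>) ^ Suc k"
        using assms by (intro powr_realpow) auto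
      finally show ?thesis
        using Gpos[of k] \<open>c \<noteq> 0\<close> by (simp add: v_def Beta_def power_mult_distrib algebra_simps)
    qed
    ultimately show ?thesis by (simp only:)
  qed
  \<comment> \<open>Taking norms replaces \<open>c\<close> by its absolute value, so the absolute convergence needed to
    exchange sum and integral is the convergence of the same series at another argument.\<close>
  have norm_f: "norm (f c k s) = f \<bar>c\<bar> k s" for k s
    using Gpos[of k] by (simp add: f_def abs_mult power_abs)
  have v: "v c sums (Gamma \<alpha> / c * (mittag_leffler \<alpha> (c * t powr \<alpha>) - 1))" for c
  proof -
    have "(\<lambda>k. (c * t powr \<alpha>) ^ Suc k / Gamma (\<alpha> * real (Suc k) + 1)) sums
          (mittag_leffler \<alpha> (c * t powr \<alpha>) - 1)"
      using mittag_leffler_sums[OF assms(1), of "c * t powr \<alpha>"] by (subst sums_Suc_iff) simp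
    thus ?thesis unfolding v_def by (rule sums_mult)
  qed
  have sumf: "summable (\<lambda>k. norm (f c k s))" for s
    unfolding norm_f unfolding f_def by (intro summable_mult summable_mittag_leffler assms)
  have sumi: "summable (\<lambda>k. LINT s|lborel. norm (f c k s))"
    unfolding norm_f using sums_summable[OF v[of "\<bar>c\<bar>"]] f[of "\<bar>c\<bar>"] assms(3)
    by (simp add: has_bochner_integral_iff)
  have fi: "integrable lborel (f c k)" "integral\<^sup>L lborel (f c k) = v c k" for k
    using f[OF assms(3)] by (auto simp: has_bochner_integral_iff)
  have "has_bochner_integral lborel (\<lambda>s. \<Sum>k. f c k s) (\<Sum>k. v c k)"
    unfolding has_bochner_integral_iff
    using integrable_suminf[of lborel "f c", OF fi(1) _ sumi] integral_suminf[of lborel "f c", OF fi(1) _ sumi]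
      sumf by (simp add: fi(2))
  moreover have "(\<Sum>k. f c k s) = indicator {0<..<t} s *
       ((t - s) powr (\<alpha> - 1) * mittag_leffler \<alpha> (c * s powr \<alpha>))" for s
    unfolding f_def using mittag_leffler_sums[OF assms(1), of "c * s powr \<alpha>"]
    by (intro sums_unique[symmetric] sums_mult)
  ultimately show ?thesis using sums_unique[OF v[of c]] by simp
qed


section \<open>The Laplace transform of the Mittag-Leffler function\<close>

lemma nn_integral_laplace_powr:
  fixes a z :: real
  assumes "0 < a" "0 < z"
  shows "(\<integral>\<^sup>+u. ennreal (indicator {0<..} u * (u powr (a - 1) * exp (- z * u))) \<partial>lborel)
           = ennreal (Gamma a / z powr a)"
proof -
  let ?I = "\<integral>\<^sup>+u. ennreal (indicator {0<..} u * (u powr (a - 1) * exp (- z * u))) \<partial>lborel"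
  have "ennreal (Gamma a) = (\<integral>\<^sup>+t. ennreal (indicator {0..} t * t powr (a - 1) / exp t) \<partial>lborel)"
    by (rule Gamma_conv_nn_integral_real) fact
  also have "\<dots> = ennreal \<bar>z\<bar> *
      (\<integral>\<^sup>+u. ennreal (indicator {0..} (0 + z * u) * (0 + z * u) powr (a - 1) / exp (0 + z * u)) \<partial>lborel)"
    by (rule nn_integral_real_affine) (use assms in auto)
  also have "\<dots> = ennreal z * (\<integral>\<^sup>+u. ennreal (z powr (a - 1)) *
      ennreal (indicator {0<..} u * (u powr (a - 1) * exp (- z * u))) \<partial>lborel)"
  proof -
    have "indicator {0..} (0 + z * u) * (0 + z * u) powr (a - 1) / exp (0 + z * u) =
          z powr (a - 1) * (indicator {0<..} u * (u powr (a - 1) * exp (- z * u)))" for u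
      using assms by (cases "u > 0") (auto simp: indicator_def zero_le_mult_iff powr_mult exp_minus field_simps)
    thus ?thesis using assms by (simp only: ennreal_mult' powr_ge_zero abs_of_pos)
  qed
  also have "\<dots> = ennreal z * (ennreal (z powr (a - 1)) * ?I)"
    by (subst nn_integral_cmult) auto
  also have "\<dots> = ennreal (z powr a) * ?I"
  proof -
    have "z powr a = z * z powr (a - 1)"
      using assms powr_add[of z 1 "a - 1"] by simp
    thus ?thesis using assms by (simp add: ennreal_mult mult.assoc)
  qed
  finally have "ennreal (Gamma a) = ennreal (z powr a) * ?I" .
  hence "ennreal (1 / z powr a) * ennreal (Gamma a) = ennreal (1 / z powr a * z powr a) * ?I"
    using assms by (simp only: mult.assoc[symmetric] ennreal_mult[symmetric] zero_le_divide_1_iff powr_ge_zero)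
  thus ?thesis using assms by (simp flip: ennreal_mult)
qed

lemma nn_integral_convolution:
  fixes f g :: "real \<Rightarrow> ennreal"
  assumes [measurable]: "f \<in> borel_measurable borel" "g \<in> borel_measurable borel"
  shows "(\<integral>\<^sup>+t. \<integral>\<^sup>+s. f s * g (t - s) \<partial>lborel \<partial>lborel) = (\<integral>\<^sup>+s. f s \<partial>lborel) * (\<integral>\<^sup>+u. g u \<partial>lborel)"
proof -
  have "(\<integral>\<^sup>+t. \<integral>\<^sup>+s. f s * g (t - s) \<partial>lborel \<partial>lborel) = (\<integral>\<^sup>+s. \<integral>\<^sup>+t. f s * g (t - s) \<partial>lborel \<partial>lborel)"
    by (rule lborel_pair.Fubini') measurable
  also have "\<dots> = (\<integral>\<^sup>+s. f s * (\<integral>\<^sup>+u. g u \<partial>lborel) \<partial>lborel)"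
  proof (intro nn_integral_cong)
    fix s :: real
    have "(\<integral>\<^sup>+t. g t \<partial>lborel) = (\<integral>\<^sup>+t. g (t - s) \<partial>lborel)"
      using nn_integral_real_affine[of g 1 "- s"] by simp
    thus "(\<integral>\<^sup>+t. f s * g (t - s) \<partial>lborel) = f s * (\<integral>\<^sup>+u. g u \<partial>lborel)"
      by (simp add: nn_integral_cmult)
  qed
  also have "\<dots> = (\<integral>\<^sup>+s. f s \<partial>lborel) * (\<integral>\<^sup>+u. g u \<partial>lborel)"
    by (rule nn_integral_multc) measurable
  finally show ?thesis .
qed

text \<open>The Laplace transform turns the convolution in \<open>mittag_leffler_volterra\<close> into a product.
  The bounds on the function make every integrand non-negative, which justifies this for
  all \<open>z > 0\<close>, and they make the transform finite, so that the resulting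
  linear equation can be solved for it.\<close>

lemma nn_integral_laplace_mittag_leffler:
  fixes \<alpha> l z :: real
  assumes "0 < \<alpha>" "0 < l" "0 < z"
    and bounds: "\<And>t. 0 < t \<Longrightarrow> mittag_leffler \<alpha> (- l * t powr \<alpha>) \<in> {0..1}"
  shows "(\<integral>\<^sup>+t. ennreal (indicator {0<..} t * (exp (- z * t) * mittag_leffler \<alpha> (- l * t powr \<alpha>))) \<partial>lborel)
           = ennreal (z powr \<alpha> / (z * (z powr \<alpha> + l)))"
proof -
  define G where "G t = mittag_leffler \<alpha> (- l * t powr \<alpha>)" for t
  have [measurable]: "G \<in> borel_measurable borel" unfolding G_def[abs_def] by measurable
  define g where "g t = indicator {0<..} t * (exp (- z * t) * G t)" for t :: real
  define h where "h t = indicator {0<..} t * (exp (- z * t) * (1 - G t))" for t :: real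
  define k where "k u = indicator {0<..} u * (u powr (\<alpha> - 1) * exp (- z * u))" for u :: real
  define L where "L = (\<integral>\<^sup>+t. ennreal (g t) \<partial>lborel)"
  define H where "H = (\<integral>\<^sup>+t. ennreal (h t) \<partial>lborel)"
  have [measurable]: "g \<in> borel_measurable borel" "h \<in> borel_measurable borel" "k \<in> borel_measurable borel"
    unfolding g_def[abs_def] h_def[abs_def] k_def[abs_def] by measurable
  have G01: "0 \<le> G t" "G t \<le> 1" if "0 < t" for t
    using bounds[OF that] by (auto simp: G_def)
  have nonneg: "0 \<le> g t" "0 \<le> h t" "0 \<le> k t" for t
    using G01[of t] by (auto simp: g_def h_def k_def indicator_def)
  have "L + H = (\<integral>\<^sup>+t. ennreal (g t) + ennreal (h t) \<partial>lborel)"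
    unfolding L_def H_def by (rule nn_integral_add[symmetric]) measurable
  also have "\<dots> = (\<integral>\<^sup>+t. ennreal (indicator {0<..} t * (t powr (1 - 1) * exp (- z * t))) \<partial>lborel)"
  proof (intro nn_integral_cong)
    fix t :: real
    have "g t + h t = indicator {0<..} t * (t powr (1 - 1) * exp (- z * t))"
      by (simp add: g_def h_def indicator_def algebra_simps)
    thus "ennreal (g t) + ennreal (h t) = ennreal (indicator {0<..} t * (t powr (1 - 1) * exp (- z * t)))"
      by (simp only: nonneg flip: ennreal_plus)
  qed
  also have "\<dots> = ennreal (1 / z)"
    using nn_integral_laplace_powr[of 1 z] assms by simp
  finally have LH: "L + H = ennreal (1 / z)" .
  have conv: "(\<integral>\<^sup>+s. ennreal (g s) * ennreal (k (t - s)) \<partial>lborel) = ennreal (Gamma \<alpha> / l) * ennreal (h t)" for t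
  proof (cases "0 < t")
    case False
    hence "ennreal (g s) * ennreal (k (t - s)) = 0" for s
      by (auto simp: g_def k_def indicator_def)
    note vanish = this
    show ?thesis unfolding vanish using False by (simp add: h_def)
  next
    case True
    have "has_bochner_integral lborel
        (\<lambda>s. exp (- z * t) * (indicator {0<..<t} s * ((t - s) powr (\<alpha> - 1) * G s)))
        (exp (- z * t) * (Gamma \<alpha> / (- l) * (G t - 1)))"
      unfolding G_def
      by (intro has_bochner_integral_mult_right mittag_leffler_volterra) (use True assms in auto)
    moreover have "exp (- z * t) * (indicator {0<..<t} s * ((t - s) powr (\<alpha> - 1) * G s)) = g s * k (t - s)" for s
      using exp_add[of "- z * s" "- z * (t - s)"]
      by (auto simp: g_def k_def indicator_def algebra_simps)
    moreover have "exp (- z * t) * (Gamma \<alpha> / (- l) * (G t - 1)) = Gamma \<alpha> / l * h t"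
      using True assms by (simp add: h_def field_simps)
    ultimately have "has_bochner_integral lborel (\<lambda>s. g s * k (t - s)) (Gamma \<alpha> / l * h t)"
      by simp
    hence "(\<integral>\<^sup>+s. ennreal (g s * k (t - s)) \<partial>lborel) = ennreal (Gamma \<alpha> / l * h t)"
      by (subst nn_integral_eq_integral) (auto simp: has_bochner_integral_iff nonneg)
    moreover have "0 \<le> Gamma \<alpha> / l"
      using assms Gamma_real_pos[of \<alpha>] by simp
    ultimately show ?thesis by (simp only: ennreal_mult nonneg)
  qed
  have "ennreal (Gamma \<alpha> / l) * H = (\<integral>\<^sup>+t. \<integral>\<^sup>+s. ennreal (g s) * ennreal (k (t - s)) \<partial>lborel \<partial>lborel)"
    unfolding H_def conv by (rule nn_integral_cmult[symmetric]) measurable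
  also have "\<dots> = L * (\<integral>\<^sup>+u. ennreal (k u) \<partial>lborel)"
    unfolding L_def by (rule nn_integral_convolution) measurable
  also have "(\<integral>\<^sup>+u. ennreal (k u) \<partial>lborel) = ennreal (Gamma \<alpha> / z powr \<alpha>)"
    unfolding k_def using assms by (intro nn_integral_laplace_powr)
  finally have HL: "ennreal (Gamma \<alpha> / l) * H = L * ennreal (Gamma \<alpha> / z powr \<alpha>)" .
  have "L \<noteq> \<top>" "H \<noteq> \<top>" using LH by auto
  then obtain x y where xy: "0 \<le> x" "L = ennreal x" "0 \<le> y" "H = ennreal y"
    by (cases L; cases H) auto
  have "x + y = 1 / z"
    using LH xy assms by (simp flip: ennreal_plus)
  moreover have "Gamma \<alpha> / l * y = x * (Gamma \<alpha> / z powr \<alpha>)"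
    using HL xy assms by (simp flip: ennreal_mult)
  hence "y = x * l / z powr \<alpha>"
    using assms less_imp_neq[OF Gamma_real_pos[OF assms(1)]] by (simp add: field_simps)
  ultimately have "x * (z * (z powr \<alpha> + l)) = z powr \<alpha>"
    using assms by (simp add: field_simps)
  moreover have "z powr \<alpha> + l > 0" using assms by (intro add_nonneg_pos) auto
  ultimately have "x = z powr \<alpha> / (z * (z powr \<alpha> + l))"
    using assms(3) by (simp add: eq_divide_eq)
  thus ?thesis using xy by (simp add: L_def g_def G_def)
qed

section \<open>Sums of independent Mittag-Leffler variables\<close>

text \<open>Layer-cake formula: \<open>1 - exp (- z y)\<close> is the integral of its derivative in \<open>y\<close>, and
  exchanging this integral with the expectation produces the tail probabilities.\<close>

lemma (in prob_space) nn_integral_one_minus_exp: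
  fixes Y :: "'a \<Rightarrow> real"
  assumes [measurable]: "random_variable borel Y" and nonneg: "AE \<omega> in M. 0 \<le> Y \<omega>" and "0 < z"
  shows "(\<integral>\<^sup>+\<omega>. ennreal (1 - exp (- z * Y \<omega>)) \<partial>M) =
           (\<integral>\<^sup>+t. ennreal (indicator {0<..} t * (z * exp (- z * t) * prob {\<omega> \<in> space M. t < Y \<omega>})) \<partial>lborel)"
proof -
  define u where "u t y = ennreal (z * exp (- z * t)) * indicator {0<..<y} t" for t y :: real
  have u_meas: "(\<lambda>(t, \<omega>). u t (Y \<omega>)) \<in> borel_measurable (lborel \<Otimes>\<^sub>M M)"
    unfolding u_def indicator_def greaterThanLessThan_iff by measurable
  have "(\<integral>\<^sup>+t. u t y \<partial>lborel) = ennreal (1 - exp (- z * y))" if "0 \<le> y" for y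
  proof -
    have "((\<lambda>t. z * exp (- z * t)) has_integral (- exp (- z * y) - (- exp (- z * 0)))) {0..y}"
      by (rule fundamental_theorem_of_calculus)
         (use that in \<open>auto intro!: derivative_eq_intros simp flip: has_real_derivative_iff_has_vector_derivative\<close>)
    hence "((\<lambda>t. z * exp (- z * t)) has_integral (1 - exp (- z * y))) {0<..<y}"
      by (simp add: has_integral_Icc_iff_Ioo)
    thus ?thesis unfolding u_def
      using \<open>0 < z\<close> by (intro nn_integral_has_integral_lebesgue') auto
  qed
  hence "(\<integral>\<^sup>+\<omega>. ennreal (1 - exp (- z * Y \<omega>)) \<partial>M) = (\<integral>\<^sup>+\<omega>. \<integral>\<^sup>+t. u t (Y \<omega>) \<partial>lborel \<partial>M)"
    using nonneg by (intro nn_integral_cong_AE) (auto elim!: eventually_mono)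
  also have "\<dots> = (\<integral>\<^sup>+t. \<integral>\<^sup>+\<omega>. u t (Y \<omega>) \<partial>M \<partial>lborel)"
  proof -
    interpret pair_sigma_finite lborel M ..
    show ?thesis by (rule Fubini'[OF u_meas])
  qed
  also have "\<dots> = (\<integral>\<^sup>+t. ennreal (indicator {0<..} t * (z * exp (- z * t) * prob {\<omega> \<in> space M. t < Y \<omega>})) \<partial>lborel)"
  proof (intro nn_integral_cong)
    fix t :: real
    have "(\<integral>\<^sup>+\<omega>. u t (Y \<omega>) \<partial>M) =
        (\<integral>\<^sup>+\<omega>. ennreal (indicator {0<..} t * (z * exp (- z * t))) * indicator {\<omega> \<in> space M. t < Y \<omega>} \<omega> \<partial>M)"
      by (intro nn_integral_cong) (auto simp: u_def indicator_def)
    also have "\<dots> = ennreal (indicator {0<..} t * (z * exp (- z * t))) * emeasure M {\<omega> \<in> space M. t < Y \<omega>}"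
      by (rule nn_integral_cmult_indicator) measurable
    finally show "(\<integral>\<^sup>+\<omega>. u t (Y \<omega>) \<partial>M) =
        ennreal (indicator {0<..} t * (z * exp (- z * t) * prob {\<omega> \<in> space M. t < Y \<omega>}))"
      using \<open>0 < z\<close> by (simp add: emeasure_eq_measure mult.assoc flip: ennreal_mult)
  qed
  finally show ?thesis .
qed

lemma (in prob_space) mittag_leffler_tail_imp:
  fixes Y :: "'a \<Rightarrow> real" and \<alpha> l :: real
  assumes "0 < \<alpha>" "0 < l"
    and [measurable]: "random_variable borel Y"
    and tail: "\<And>t. 0 \<le> t \<Longrightarrow> prob {\<omega> \<in> space M. t < Y \<omega>} = mittag_leffler \<alpha> (- l * t powr \<alpha>)"
  shows mittag_leffler_tail_imp_nonneg: "AE \<omega> in M. 0 \<le> Y \<omega>"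
    and mittag_leffler_tail_imp_laplace:
      "\<And>z. 0 < z \<Longrightarrow> expectation (\<lambda>\<omega>. exp (- z * Y \<omega>)) = l / (z powr \<alpha> + l)"
proof -
  \<comment> \<open>Non-negativity is hidden in the tail at \<open>t = 0\<close>, where the series has value \<open>1\<close>.\<close>
  have "prob {\<omega> \<in> space M. 0 < Y \<omega>} = 1"
    using tail[of 0] by (simp add: mittag_leffler_0)
  hence "AE \<omega> in M. 0 < Y \<omega>" by (subst (asm) prob_Collect_eq_1) auto
  thus nonneg: "AE \<omega> in M. 0 \<le> Y \<omega>" by (auto elim!: eventually_mono)
  fix z :: real assume z: "0 < z"
  have bounds: "mittag_leffler \<alpha> (- l * t powr \<alpha>) \<in> {0..1}" if "0 < t" for t
    using tail[of t] that measure_nonneg[of M] prob_le_1 by (metis atLeastAtMost_iff less_imp_le)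
  have exp_le: "AE \<omega> in M. exp (- z * Y \<omega>) \<le> 1"
    using nonneg z by (auto elim!: eventually_mono)
  have int: "integrable M (\<lambda>\<omega>. exp (- z * Y \<omega>))"
    by (rule integrable_const_bound[of _ 1]) (use exp_le in auto)
  have pos: "z powr \<alpha> + l > 0" using assms by (intro add_nonneg_pos) auto
  have "ennreal (1 - expectation (\<lambda>\<omega>. exp (- z * Y \<omega>))) = ennreal (expectation (\<lambda>\<omega>. 1 - exp (- z * Y \<omega>)))"
    using int by (simp add: prob_space)
  also have "\<dots> = (\<integral>\<^sup>+\<omega>. ennreal (1 - exp (- z * Y \<omega>)) \<partial>M)"
    using int exp_le by (intro nn_integral_eq_integral[symmetric]) auto
  also have "\<dots> = (\<integral>\<^sup>+t. ennreal (indicator {0<..} t *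
      (z * exp (- z * t) * prob {\<omega> \<in> space M. t < Y \<omega>})) \<partial>lborel)"
    by (rule nn_integral_one_minus_exp) (use nonneg z in auto)
  also have "\<dots> = (\<integral>\<^sup>+t. ennreal z * ennreal (indicator {0<..} t *
      (exp (- z * t) * mittag_leffler \<alpha> (- l * t powr \<alpha>))) \<partial>lborel)"
    using z by (intro nn_integral_cong) (auto simp: indicator_def tail mult.assoc ennreal_mult')
  also have "\<dots> = ennreal z * ennreal (z powr \<alpha> / (z * (z powr \<alpha> + l)))"
    by (subst nn_integral_cmult) (use nn_integral_laplace_mittag_leffler[OF assms(1,2) z bounds] in auto)
  also have "\<dots> = ennreal (z powr \<alpha> / (z powr \<alpha> + l))"
    using z pos by (simp flip: ennreal_mult)
  finally have "1 - expectation (\<lambda>\<omega>. exp (- z * Y \<omega>)) = z powr \<alpha> / (z powr \<alpha> + l)"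
    using pos integral_mono_AE[OF int integrable_const exp_le]
    by (subst (asm) ennreal_inj) (auto simp: prob_space)
  thus "expectation (\<lambda>\<omega>. exp (- z * Y \<omega>)) = l / (z powr \<alpha> + l)"
    using pos by (simp add: field_simps)
qed

theorem proposition4p1:
  fixes M :: "'a measure" and X :: "'a \<Rightarrow> real" and Y :: "nat \<Rightarrow> 'a \<Rightarrow> real"
    and \<alpha> \<delta> l :: real and n :: nat
  assumes "prob_space M"
    and "0 < \<alpha>" and "\<alpha> \<le> 1" and "0 < \<delta>" and "0 < l" and "1 \<le> n"
    and "prob_space.generalized_mittag_leffler M X \<alpha> \<delta> l"
    and "prob_space.indep_vars M (\<lambda>_. borel) (\<lambda>i. if i = 0 then X else Y i) {0..n}"
    and "\<And>i t. 1 \<le> i \<Longrightarrow> i \<le> n \<Longrightarrow> 0 \<le> t \<Longrightarrow>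
           measure M {\<omega> \<in> space M. t < Y i \<omega>} = mittag_leffler \<alpha> (- l * t powr \<alpha>)"
  shows "prob_space.generalized_mittag_leffler M (\<lambda>\<omega>. X \<omega> + (\<Sum>i=1..n. Y i \<omega>)) \<alpha> (\<delta> + real n) l"
proof -
  interpret prob_space M by fact
  define Z where "Z i = (if i = 0 then X else Y i)" for i
  have indep: "indep_vars (\<lambda>_. borel) Z {0..n}"
    using assms(8) by (simp add: Z_def[abs_def])
  have X: "random_variable borel X" "AE \<omega> in M. 0 \<le> X \<omega>"
    "\<And>z. 0 < z \<Longrightarrow> expectation (\<lambda>\<omega>. exp (- z * X \<omega>)) = (l / (z powr \<alpha> + l)) powr \<delta>"
    using assms(7) by (auto simp: generalized_mittag_leffler_def)
  have rv: "random_variable borel (Y i)" if "i \<in> {1..n}" for i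
    using indep_vars_def2[of "\<lambda>_. borel" Z "{0..n}"] indep that
    by (force simp: Z_def)
  have Y_nonneg: "AE \<omega> in M. 0 \<le> Y i \<omega>" if "i \<in> {1..n}" for i
    using that by (intro mittag_leffler_tail_imp_nonneg[OF assms(2,5) rv assms(9)]) auto
  have Y_laplace: "expectation (\<lambda>\<omega>. exp (- z * Y i \<omega>)) = l / (z powr \<alpha> + l)"
    if "i \<in> {1..n}" "0 < z" for i z
    using that by (intro mittag_leffler_tail_imp_laplace[OF assms(2,5) rv assms(9)]) auto
  have split: "{0..n} = insert 0 {1..n}" by auto
  have Z_sum: "X \<omega> + (\<Sum>i=1..n. Y i \<omega>) = (\<Sum>i\<in>{0..n}. Z i \<omega>)" for \<omega>
    by (simp add: split Z_def)
  have Z_nonneg: "AE \<omega> in M. 0 \<le> Z i \<omega>" if "i \<in> {0..n}" for i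
    using that X(2) Y_nonneg by (auto simp: Z_def)
  have Z_rv: "random_variable borel (Z i)" if "i \<in> {0..n}" for i
    using that X(1) rv by (auto simp: Z_def)
  have laplace: "expectation (\<lambda>\<omega>. exp (- z * (\<Sum>i\<in>{0..n}. Z i \<omega>))) = (l / (z powr \<alpha> + l)) powr (\<delta> + real n)"
    if z: "0 < z" for z
  proof -
    have pos: "l / (z powr \<alpha> + l) > 0" using assms by (intro divide_pos_pos add_nonneg_pos) auto
    have "indep_vars (\<lambda>_. borel) (\<lambda>i \<omega>. exp (- z * Z i \<omega>)) {0..n}"
      by (rule indep_vars_compose2[OF indep]) auto
    moreover have "integrable M (\<lambda>\<omega>. exp (- z * Z i \<omega>))" if "i \<in> {0..n}" for i
      by (rule integrable_const_bound[of _ 1])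
         (use Z_nonneg[OF that] Z_rv[OF that] z in \<open>auto elim!: eventually_mono\<close>)
    ultimately have "expectation (\<lambda>\<omega>. \<Prod>i\<in>{0..n}. exp (- z * Z i \<omega>)) =
        (\<Prod>i\<in>{0..n}. expectation (\<lambda>\<omega>. exp (- z * Z i \<omega>)))"
      by (intro indep_vars_lebesgue_integral) auto
    also have "\<dots> = (l / (z powr \<alpha> + l)) powr \<delta> * (\<Prod>i\<in>{1..n}. l / (z powr \<alpha> + l))"
      using X(3)[OF z] Y_laplace[OF _ z] by (simp add: split Z_def)
    also have "\<dots> = (l / (z powr \<alpha> + l)) powr (\<delta> + real n)"
      using pos by (simp add: powr_add powr_realpow del: zero_less_divide_iff)
    finally show ?thesis by (simp add: sum_distrib_left exp_sum)
  qed
  show ?thesis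
    unfolding generalized_mittag_leffler_def Z_sum
  proof (intro conjI allI impI laplace)
    show "random_variable borel (\<lambda>\<omega>. \<Sum>i\<in>{0..n}. Z i \<omega>)"
      using Z_rv by (intro borel_measurable_sum) auto
    have "AE \<omega> in M. \<forall>i\<in>{0..n}. 0 \<le> Z i \<omega>"
      using Z_nonneg by (subst AE_ball_countable) auto
    thus "AE \<omega> in M. 0 \<le> (\<Sum>i\<in>{0..n}. Z i \<omega>)"
      by (auto elim!: eventually_mono intro!: sum_nonneg)
  qed (use assms in auto)
qed

end
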